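(* Let $\mathcal{C}: Sym\to Sym$ be a symmetric and positive definite fourth-order tensor, let $\mathbf{D}\in Sym$ and $\sigma\in(0,1]$ be fixed, and let $(\mu^{(k)})_k$ be a monotonically decreasing sequence of positive numbers with $\lim_{k\to\infty}\mu^{(k)}=0$. For each $k$, let $(\mathbf{X}^{(k)},\mathbf{S}^{(k)})\in Sym^{++}\times Sym^{++}$ be the point of the central path corresponding to $\mu^{(k)}$, i.e. $$\mathbf{S}^{(k)}=\mathcal{C}(\mathbf{X}^{(k)}+\mathbf{D}),\qquad \mathbf{X}^{(k)}\mathbf{S}^{(k)}=\sigma\mu^{(k)}\mathbf{I}.$$ Assume that $(\mathbf{X}^{(k)},\mathbf{S}^{(k)})$ converges to a pair $(\mathbf{X}^*,\mathbf{S}^* )$ that is the optimal solution, i.e. $\mathbf{X}^*,\mathbf{S}^*\in Sym^{+}$, $\mathbf{S}^*=\mathcal{C}(\mathbf{X}^*+\mathbf{D})$, $\mathbf{X}^*\bullet\mathbf{S}^*=0$, and that $\mathrm{rank}(\mathbf{X}^* )+\mathrm{rank}(\mathbf{S}^* )=3$. Let $\mathcal{S}_{NT}^{(k)}=(\mathbf{W}^{(k)}\odot\mathbf{W}^{(k)})+\mathcal{C}^{-1}$ be the Nesterov--Todd Schur complement tensor at $(\mathbf{X}^{(k)},\mathbf{S}^{(k)})$, and let $\kappa(\mathcal{S}_{NT}^{(k)})$ be its condition number. Then: (a) if $\mathrm{rank}(\mathbf{S}^* )=3$ (so $\mathbf{X}^*=\mathbf{0}$) or $\mathrm{rank}(\mathbf{S}^*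 )=0$ (so $\mathbf{X}^*$ is positive definite), then $\kappa(\mathcal{S}_{NT}^{(k)})$ is bounded as $k\to\infty$; (b) if $\mathrm{rank}(\mathbf{S}^* )=2$ or $\mathrm{rank}(\mathbf{S}^* )=1$, then $\kappa(\mathcal{S}_{NT}^{(k)})=O\big((\mu^{(k)})^{-1}\big)$ as $k\to\infty$.
   Context: Let $\mathcal{V}$ be a real inner product space of dimension 3. $Lin$ is the space of linear maps $\mathcal{V}\to\mathcal{V}$ (second-order tensors) with inner product $\mathbf{A}\bullet\mathbf{B}=\mathrm{tr}(\mathbf{A}^T\mathbf{B})$, and $\mathbf{I}$ is the identity. $Sym\subset Lin$ is the subspace of symmetric tensors, with $Sym^{+}$, $Sym^{++}$ its positive semidefinite and positive definite elements. A fourth-order tensor $\mathcal{C}$ from $Sym$ to $Sym$ is a linear map $Sym\to Sym$; it is symmetric if $\mathbf{A}\bullet\mathcal{C}(\mathbf{B})=\mathbf{B}\bullet\mathcal{C}(\mathbf{A})$ for all $\mathbf{A},\mathbf{B}\in Sym$ and positive definite if $\mathbf{A}\bullet\mathcal{C}(\mathbf{A})>0$ for all nonzero $\mathbf{A}\in Sym$; such $\mathcal{C}$ is invertible with inverse $\mathcal{C}^{-1}$. For $\mathbf{A},\mathbf{B}\in Lin$, $\mathbf{A}\odot\mathbf{B}$ is the fourth-order tensor $\mathbf{A}\odot\mathbf{B}(\mathbf{H})=\frac12(\mathbf{B}\mathbf{H}\mathbf{A}^T+\mathbf{A}\mathbf{H}^T\mathbf{B}^T)$; in particular, for $\mathbf{W},\mathbf{H}\in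 Sym$, $(\mathbf{W}\odot\mathbf{W})(\mathbf{H})=\mathbf{W}\mathbf{H}\mathbf{W}$. The tensor $\mathbf{W}^{(k)}$ is the geometric mean of $\mathbf{X}=\mathbf{X}^{(k)}$ and $\mathbf{S}^{-1}$, $\mathbf{S}=\mathbf{S}^{(k)}$, namely $$\mathbf{W}^{(k)}=\mathbf{X}^{1/2}(\mathbf{X}^{1/2}\mathbf{S}\mathbf{X}^{1/2})^{-1/2}\mathbf{X}^{1/2}\in Sym^{++}.$$ The tensor $\mathcal{S}_{NT}^{(k)}$ is regarded as a symmetric positive definite linear operator on $(Sym,\bullet)$, and its condition number is the ratio $\kappa=\lambda_{\max}/\lambda_{\min}$ of its largest to its smallest eigenvalue. *)

theory Defs
  imports "HOL-Analysis.Analysis" "HOL-Library.Landau_Symbols"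
begin

(* Second-order tensors on a finite-dimensional real inner product space 'v. In finite dimension
   every linear map is bounded, and the operator norm carried by this type induces the same
   topology as the norm of the inner product lin_inner below. *)
type_synonym 'v lin = "'v \<Rightarrow>\<^sub>L 'v"

definition lin_transpose :: "'v::euclidean_space lin \<Rightarrow> 'v lin" where
  "lin_transpose A = Blinfun (adjoint (blinfun_apply A))"

definition lin_trace :: "'v::euclidean_space lin \<Rightarrow> real" where
  "lin_trace A = (\<Sum>b\<in>Basis. b \<bullet> blinfun_apply A b)"

definition lin_inner :: "'v::euclidean_space lin \<Rightarrow> 'v lin \<Rightarrow> real" where
  "lin_inner A B = lin_trace (lin_transpose A o\<^sub>L B)"

definition lin_rank :: "'v::euclidean_space lin \<Rightarrow> nat" where
  "lin_rank A = dim (range (blinfun_apply A))"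

definition Sym :: "'v::euclidean_space lin set" where
  "Sym = {A. lin_transpose A = A}"

definition Sym_psd :: "'v::euclidean_space lin set" where
  "Sym_psd = {A \<in> Sym. \<forall>v. 0 \<le> v \<bullet> blinfun_apply A v}"

definition Sym_pd :: "'v::euclidean_space lin set" where
  "Sym_pd = {A \<in> Sym. \<forall>v. v \<noteq> 0 \<longrightarrow> 0 < v \<bullet> blinfun_apply A v}"

definition lin_inverse :: "'v::euclidean_space lin \<Rightarrow> 'v lin" where
  "lin_inverse A = (THE B. A o\<^sub>L B = id_blinfun \<and> B o\<^sub>L A = id_blinfun)"

definition lin_sqrt :: "'v::euclidean_space lin \<Rightarrow> 'v lin" where
  "lin_sqrt A = (THE B. B \<in> Sym_psd \<and> B o\<^sub>L B = A)"

(* A fourth-order tensor from Sym to Sym is represented by a function on the whole type of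
   second-order tensors; only its values on Sym are meaningful. *)
definition fourth_order_tensor :: "('v::euclidean_space lin \<Rightarrow> 'v lin) \<Rightarrow> bool" where
  "fourth_order_tensor T \<longleftrightarrow>
     (\<forall>A\<in>Sym. T A \<in> Sym) \<and>
     (\<forall>A\<in>Sym. \<forall>B\<in>Sym. T (A + B) = T A + T B) \<and>
     (\<forall>c. \<forall>A\<in>Sym. T (c *\<^sub>R A) = c *\<^sub>R T A)"

definition tensor_symmetric :: "('v::euclidean_space lin \<Rightarrow> 'v lin) \<Rightarrow> bool" where
  "tensor_symmetric T \<longleftrightarrow> (\<forall>A\<in>Sym. \<forall>B\<in>Sym. lin_inner A (T B) = lin_inner B (T A))"

definition tensor_pos_def :: "('v::euclidean_space lin \<Rightarrow> 'v lin) \<Rightarrow> bool" where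
  "tensor_pos_def T \<longleftrightarrow> (\<forall>A\<in>Sym. A \<noteq> 0 \<longrightarrow> 0 < lin_inner A (T A))"

definition tensor_inverse :: "('v::euclidean_space lin \<Rightarrow> 'v lin) \<Rightarrow> 'v lin \<Rightarrow> 'v lin" where
  "tensor_inverse T = inv_into Sym T"

definition sym_prod :: "'v::euclidean_space lin \<Rightarrow> 'v lin \<Rightarrow> 'v lin \<Rightarrow> 'v lin" where
  "sym_prod A B H =
     (1/2) *\<^sub>R ((B o\<^sub>L H o\<^sub>L lin_transpose A) + (A o\<^sub>L lin_transpose H o\<^sub>L lin_transpose B))"

lemma sym_prod_Sym:
  assumes "W \<in> Sym" and "H \<in> Sym"
  shows "sym_prod W W H = W o\<^sub>L H o\<^sub>L W"
  using assms by (simp add: sym_prod_def Sym_def flip: scaleR_add_left scaleR_2)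

definition tensor_eigenvalues :: "('v::euclidean_space lin \<Rightarrow> 'v lin) \<Rightarrow> real set" where
  "tensor_eigenvalues T = {l. \<exists>H\<in>Sym. H \<noteq> 0 \<and> T H = l *\<^sub>R H}"

definition condition_number :: "('v::euclidean_space lin \<Rightarrow> 'v lin) \<Rightarrow> real" where
  "condition_number T = Max (tensor_eigenvalues T) / Min (tensor_eigenvalues T)"

definition NT_scaling :: "'v::euclidean_space lin \<Rightarrow> 'v lin \<Rightarrow> 'v lin" where
  "NT_scaling X S =
     lin_sqrt X o\<^sub>L lin_inverse (lin_sqrt (lin_sqrt X o\<^sub>L S o\<^sub>L lin_sqrt X)) o\<^sub>L lin_sqrt X"

definition NT_schur ::
  "('v::euclidean_space lin \<Rightarrow> 'v lin) \<Rightarrow> 'v lin \<Rightarrow> 'v lin \<Rightarrow> 'v lin \<Rightarrow> 'v lin" where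
  "NT_schur C X S H =
     sym_prod (NT_scaling X S) (NT_scaling X S) H + tensor_inverse C H"

definition central_path_point ::
  "('v::euclidean_space lin \<Rightarrow> 'v lin) \<Rightarrow> 'v lin \<Rightarrow> real \<Rightarrow> real \<Rightarrow> 'v lin \<Rightarrow> 'v lin \<Rightarrow> bool" where
  "central_path_point C D \<sigma> \<mu> X S \<longleftrightarrow>
     X \<in> Sym_pd \<and> S \<in> Sym_pd \<and> S = C (X + D) \<and> X o\<^sub>L S = (\<sigma> * \<mu>) *\<^sub>R id_blinfun"

definition optimal_solution ::
  "('v::euclidean_space lin \<Rightarrow> 'v lin) \<Rightarrow> 'v lin \<Rightarrow> 'v lin \<Rightarrow> 'v lin \<Rightarrow> bool" where
  "optimal_solution C D X S \<longleftrightarrow>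
     X \<in> Sym_psd \<and> S \<in> Sym_psd \<and> S = C (X + D) \<and> lin_inner X S = 0"

end

theory Submission
  imports Defs
begin

text \<open>On the central path one has \<open>X S = \<nu> I\<close> with \<open>\<nu> = \<sigma> \<mu>\<close>, so the Nesterov--Todd scaling is
  \<open>W = \<nu>\<^sup>-\<^sup>1\<^sup>/\<^sup>2 X\<close> and the Schur complement is \<open>H \<mapsto> \<nu>\<^sup>-\<^sup>1 X H X + C\<^sup>-\<^sup>1 H\<close>. If
  \<open>a I \<le> X \<le> b I\<close> and \<open>p\<close>, \<open>q\<close> are the extreme eigenvalues of \<open>C\<^sup>-\<^sup>1\<close>, the spectrum of this operator lies in
  \<open>[a\<^sup>2 / \<nu> + p, b\<^sup>2 / \<nu> + q]\<close>. A bound on \<open>X\<close> alone (\<open>a = 0\<close>) gives \<open>\<kappa> = O(1 / \<mu>)\<close>. If the limit of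
  \<open>S\<close> is positive definite then \<open>b = O(\<nu>)\<close>, and if the limit of \<open>X\<close> is, then \<open>a\<close> stays away
  from \<open>0\<close>; in both cases the quotient of the endpoints stays bounded.\<close>

section \<open>Linear algebra in finite dimension\<close>

text \<open>Near \<open>t = 0\<close> the linear term dominates, so a nonzero \<open>b\<close> would
  force a negative value for small \<open>t\<close> of the opposite sign. This is the first-order
  condition at a minimum, used for Rayleigh quotients and for kernels of semidefinite forms.\<close>

lemma linear_coefficient_zero_if_quadratic_nonneg:
  fixes b c :: real
  assumes "\<And>t. 0 \<le> 2 * t * b + t^2 * c"
  shows "b = 0"
proof (rule ccontr)
  assume "b \<noteq> 0"
  \<comment> \<open>As \<open>d\<close> exceeds both \<open>0\<close> and \<open>c\<close>, the
    choice \<open>t = - b / d\<close> turns the expression, multiplied by \<open>d^2\<close>, into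
    the negative number \<open>b^2 * (c - 2 * d)\<close>.\<close>
  define d where "d = \<bar>c\<bar> + 1"
  have d: "d > 0" "c < d" by (auto simp: d_def)
  have "0 \<le> (2 * (- b / d) * b + (- b / d)^2 * c) * d^2"
    using assms[of "- b / d"] by simp
  also have "\<dots> = b^2 * (c - 2 * d)"
    using d by (simp add: field_simps power2_eq_square)
  also have "\<dots> < 0"
    using \<open>b \<noteq> 0\<close> d by (simp add: mult_pos_neg)
  finally show False by simp
qed

text \<open>A maximiser \<open>h\<close> of the Rayleigh quotient is an eigenvector: the form
  \<open>l * g x y - g x (T y)\<close> is positive semidefinite and vanishes at \<open>(h, h)\<close>,
  hence at all \<open>(h, y)\<close>.\<close>

lemma self_adjoint_max_eigenvalue:
  fixes g :: "'a::{real_normed_vector,heine_borel} \<Rightarrow> 'a \<Rightarrow> real"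
  assumes V: "subspace V" "closed V" "V \<noteq> {0}"
    and g: "bounded_bilinear g" and g_sym: "\<And>x y. g x y = g y x"
    and g_pos: "\<And>x. x \<noteq> 0 \<Longrightarrow> 0 < g x x"
    and T: "bounded_linear T" and TV: "\<And>x. x \<in> V \<Longrightarrow> T x \<in> V"
    and T_sym: "\<And>x y. x \<in> V \<Longrightarrow> y \<in> V \<Longrightarrow> g x (T y) = g y (T x)"
  obtains l h where "h \<in> V" "h \<noteq> 0" "T h = l *\<^sub>R h"
    "\<And>x. x \<in> V \<Longrightarrow> g x (T x) \<le> l * g x x"
proof -
  interpret g: bounded_bilinear g by fact
  interpret T: bounded_linear T by fact
  define f where "f x = g x (T x) / g x x" for x
  \<comment> \<open>The quotient \<open>f\<close> is invariant under nonzero scaling, so its maximum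
    on the compact unit sphere \<open>K\<close> of \<open>V\<close> bounds it on all nonzero vectors
    of \<open>V\<close>.\<close>
  define K where "K = V \<inter> {x. norm x = 1}"
  obtain v where v: "v \<in> V" "v \<noteq> 0"
    using V subspace_0 by blast
  have "(1 / norm v) *\<^sub>R v \<in> K"
    using v V by (simp add: K_def subspace_scale)
  then have "K \<noteq> {}" by blast
  moreover have "closed {x::'a. norm x = 1}"
    by (intro closed_Collect_eq continuous_on_norm continuous_on_id continuous_on_const)
  then have "closed K" unfolding K_def by (rule closed_Int[OF V(2)])
  then have "compact K"
    unfolding compact_eq_bounded_closed bounded_iff by (auto simp: K_def)
  moreover have "continuous_on K f"
    unfolding f_def
  proof (intro continuous_on_divide g.continuous_on T.continuous_on continuous_on_id ballI)
    fix x assume "x \<in> K"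
    then have "x \<noteq> 0" by (auto simp: K_def)
    then show "g x x \<noteq> 0" using g_pos[of x] by simp
  qed
  ultimately obtain h where h: "h \<in> K" "\<And>x. x \<in> K \<Longrightarrow> f x \<le> f h"
    using continuous_attains_sup[of K f] by blast
  have hV: "h \<in> V" and h0: "h \<noteq> 0" using h(1) by (auto simp: K_def)
  define l where "l = f h"
  have le: "g x (T x) \<le> l * g x x" if "x \<in> V" for x
  proof (cases "x = 0")
    case False
    have "f ((1 / norm x) *\<^sub>R x) \<le> l"
      unfolding l_def using False that V by (intro h) (simp add: K_def subspace_scale)
    then have "f x \<le> l"
      using False by (simp add: f_def g.scaleR_left g.scaleR_right T.scaleR)
    then show ?thesis
      using g_pos[OF False] by (simp add: f_def field_simps)
  qed (simp add: g.zero_left)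
  have eq: "g h (T h) = l * g h h"
    using g_pos[OF h0] by (simp add: l_def f_def)
  \<comment> \<open>The residual of the eigenvalue equation serves as the direction of variation:
    the first variation of the form at \<open>h\<close> along \<open>y\<close> is twice
    \<open>g y y\<close>, so its vanishing gives \<open>y = 0\<close>.\<close>
  define y where "y = l *\<^sub>R h - T h"
  have yV: "y \<in> V"
    using V hV TV by (simp add: y_def subspace_diff subspace_scale)
  have "0 \<le> 2 * t * (l * g h y - g h (T y)) + t^2 * (l * g y y - g y (T y))" for t
  proof -
    have "h + t *\<^sub>R y \<in> V"
      using V hV yV by (simp add: subspace_add subspace_scale)
    then have "0 \<le> l * g (h + t *\<^sub>R y) (h + t *\<^sub>R y) - g (h + t *\<^sub>R y) (T (h + t *\<^sub>R y))"
      using le by (simp add: algebra_simps)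
    also have "\<dots> = 2 * t * (l * g h y - g h (T y)) + t^2 * (l * g y y - g y (T y))"
      using eq T_sym[OF hV yV] g_sym[of h y]
      by (simp add: g.add_left g.add_right g.scaleR_left g.scaleR_right T.scaleR T.add
          algebra_simps power2_eq_square)
    finally show ?thesis .
  qed
  then have "l * g h y - g h (T y) = 0"
    by (rule linear_coefficient_zero_if_quadratic_nonneg)
  moreover have "g y y = l * g h y - g h (T y)"
    using T_sym[OF hV yV] g_sym[of y h]
    by (subst (2) y_def) (simp add: g.diff_right g.scaleR_right)
  ultimately have "y = 0" using g_pos[of y] by force
  then show ?thesis using that[OF hV h0, of l] le by (simp add: y_def)
qed

text \<open>The image of a basis \<open>B\<close> of \<open>V\<close> is independent and as large as
  \<open>B\<close>. A vector of \<open>V\<close> outside its span would enlarge it to an independent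
  subset of \<open>span B\<close> with more elements than \<open>B\<close>.\<close>

lemma linear_injective_on_subspace_surjective:
  fixes f :: "'a::real_vector \<Rightarrow> 'a"
  assumes V: "subspace V" "V \<subseteq> span F" "finite F"
    and f: "linear f" "inj_on f V" "f ` V \<subseteq> V"
  shows "f ` V = V"
proof -
  obtain B where B: "B \<subseteq> V" "independent B" "V \<subseteq> span B"
    using maximal_independent_subset[of V] by blast
  have sp: "span B = V"
    using B V by (meson span_minimal subset_antisym)
  have "finite B"
    using independent_span_bound[OF V(3) B(2)] B V by auto
  have ind: "independent (f ` B)"
    using linear_independent_injective_image[OF f(1) B(2)] f(2) sp by simp
  have "y \<in> span (f ` B)" if "y \<in> V" for y
  proof (rule ccontr)
    assume y: "y \<notin> span (f ` B)"
    then have "independent (insert y (f ` B))"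
      using ind by (rule independent_insertI)
    moreover have "insert y (f ` B) \<subseteq> span B"
      using sp that B f by blast
    ultimately have "card (insert y (f ` B)) \<le> card B"
      using independent_span_bound[OF \<open>finite B\<close>] by blast
    moreover have "y \<notin> f ` B" using y by (auto intro: span_base)
    moreover have "card (f ` B) = card B"
      using inj_on_subset[OF f(2) B(1)] by (rule card_image)
    ultimately show False using \<open>finite B\<close> by simp
  qed
  then show ?thesis
    using f sp linear_span_image[OF f(1), of B] by auto
qed

section \<open>Matrix units and the finite dimension of the operator space\<close>

definition matrix_unit :: "'b::euclidean_space \<Rightarrow> 'a::euclidean_space \<Rightarrow> 'a \<Rightarrow>\<^sub>L 'b" where
  "matrix_unit i j = blinfun_scaleR_left i o\<^sub>L blinfun_inner_left j"

lemma blinfun_eq_sum_matrix_unit: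
  fixes A :: "'a::euclidean_space \<Rightarrow>\<^sub>L 'b::euclidean_space"
  shows "(\<Sum>i\<in>Basis. \<Sum>j\<in>Basis. (A j \<bullet> i) *\<^sub>R matrix_unit i j) = A"
  by (subst (2) blinfun_of_matrix_works[of A, symmetric], rule blinfun_eqI)
    (simp add: blinfun_of_matrix_apply matrix_unit_def blinfun.sum_left blinfun.scaleR_left
      inner_commute mult.commute)

text \<open>Finite dimension in the form needed to bound independent sets: it yields surjectivity of
  injective tensors and finiteness of the spectrum.\<close>

lemma finite_span_blinfun:
  obtains F :: "('a::euclidean_space \<Rightarrow>\<^sub>L 'b::euclidean_space) set" where "finite F" "span F = UNIV"
proof -
  define F :: "('a \<Rightarrow>\<^sub>L 'b) set" where "F = (\<lambda>(i, j). matrix_unit i j) ` (Basis \<times> Basis)"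
  have "(\<Sum>i\<in>Basis. \<Sum>j\<in>Basis. (A j \<bullet> i) *\<^sub>R matrix_unit i j) \<in> span F" for A :: "'a \<Rightarrow>\<^sub>L 'b"
    by (intro span_sum span_scale span_base) (auto simp: F_def)
  then have "span F = UNIV" by (auto simp: blinfun_eq_sum_matrix_unit)
  then show ?thesis using that[of F] by (simp add: F_def)
qed

text \<open>Expanding in matrix units writes \<open>f\<close> as a finite sum of fixed vectors
  scaled by matrix entries, and each entry is a bounded linear functional.\<close>

lemma linear_blinfun_imp_bounded_linear:
  fixes f :: "('a::euclidean_space \<Rightarrow>\<^sub>L 'b::euclidean_space) \<Rightarrow> 'c::real_normed_vector"
  assumes f: "linear f"
  shows "bounded_linear f"
proof -
  have "f A = (\<Sum>i\<in>Basis. \<Sum>j\<in>Basis. (A j \<bullet> i) *\<^sub>R f (matrix_unit i j))" for A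
    by (subst blinfun_eq_sum_matrix_unit[of A, symmetric])
      (simp only: linear_sum[OF f] linear_scale[OF f])
  then have "f = (\<lambda>A. \<Sum>i\<in>Basis. \<Sum>j\<in>Basis. (A j \<bullet> i) *\<^sub>R f (matrix_unit i j))" by (rule ext)
  moreover have "bounded_linear
      (\<lambda>A. \<Sum>i\<in>Basis. \<Sum>j\<in>Basis. (blinfun_apply A j \<bullet> i) *\<^sub>R f (matrix_unit i j))"
    by (intro bounded_linear_sum bounded_linear_scaleR_const
        bounded_linear_inner_left_comp blinfun.bounded_linear_left)
  ultimately show ?thesis by simp
qed

section \<open>Second-order tensors\<close>

lemma inner_lin_transpose_left: "lin_transpose A x \<bullet> y = x \<bullet> blinfun_apply A y"
proof -
  have l: "linear (blinfun_apply A)"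
    by (simp add: blinfun.bounded_linear_right bounded_linear.linear)
  then have "bounded_linear (adjoint (blinfun_apply A))"
    using adjoint_linear[OF l] by (simp only: linear_conv_bounded_linear)
  then show ?thesis
    by (simp add: lin_transpose_def bounded_linear_Blinfun_apply adjoint_clauses(2)[OF l])
qed

lemma inner_lin_transpose_right: "y \<bullet> lin_transpose A x = A y \<bullet> x"
  by (metis inner_commute inner_lin_transpose_left)

lemma lin_transpose_eqI:
  assumes "\<And>x y. blinfun_apply B x \<bullet> y = x \<bullet> blinfun_apply A y"
  shows "lin_transpose A = B"
  by (rule blinfun_eqI, rule vector_eq_rdot[THEN iffD1])
    (simp add: assms inner_lin_transpose_left)

lemma Sym_iff: "A \<in> Sym \<longleftrightarrow> (\<forall>x y. A x \<bullet> y = x \<bullet> blinfun_apply A y)"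
  unfolding Sym_def using lin_transpose_eqI[of A A] inner_lin_transpose_left[of A] by auto

lemma SymD: "A \<in> Sym \<Longrightarrow> A x \<bullet> y = x \<bullet> blinfun_apply A y"
  by (simp add: Sym_iff)

lemma lin_transpose_transpose [simp]: "lin_transpose (lin_transpose A) = A"
  by (rule lin_transpose_eqI) (simp add: inner_lin_transpose_right)

lemma lin_transpose_compose: "lin_transpose (A o\<^sub>L B) = lin_transpose B o\<^sub>L lin_transpose A"
  by (rule lin_transpose_eqI) (simp add: inner_lin_transpose_left)

lemma linear_lin_transpose: "linear lin_transpose"
  by (intro linearI lin_transpose_eqI)
    (simp_all add: blinfun.add_left blinfun.scaleR_left inner_add inner_lin_transpose_left)

lemma subspace_Sym: "subspace Sym"
  by (auto simp: subspace_def Sym_iff blinfun.add_left blinfun.scaleR_left inner_add)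

lemma closed_Sym: "closed Sym"
proof -
  have "continuous_on UNIV (lin_transpose :: 'a lin \<Rightarrow> 'a lin)"
    by (intro linear_continuous_on linear_blinfun_imp_bounded_linear linear_lin_transpose)
  then show ?thesis
    unfolding Sym_def by (intro closed_Collect_eq continuous_on_id) auto
qed

lemma id_blinfun_Sym: "id_blinfun \<in> Sym"
  by (simp add: Sym_iff)

lemma Sym_nontrivial: "(Sym :: 'v::euclidean_space lin set) \<noteq> {0}"
proof
  assume "(Sym :: 'v lin set) = {0}"
  then have "(id_blinfun :: 'v lin) = 0" using id_blinfun_Sym by blast
  then have "(b :: 'v) = 0" for b by (metis blinfun.zero_left id_blinfun.rep_eq)
  then show False by (metis nonempty_Basis nonzero_Basis ex_in_conv)
qed

lemma Sym_scaleR: "A \<in> Sym \<Longrightarrow> c *\<^sub>R A \<in> Sym"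
  by (simp add: subspace_Sym subspace_scale)

lemma Sym_compose_compose: "W \<in> Sym \<Longrightarrow> H \<in> Sym \<Longrightarrow> W o\<^sub>L H o\<^sub>L W \<in> Sym"
  by (simp add: Sym_iff)

section \<open>The Frobenius inner product\<close>

lemma lin_inner_eq_sum: "lin_inner A B = (\<Sum>b\<in>Basis. A b \<bullet> blinfun_apply B b)"
  by (simp add: lin_inner_def lin_trace_def inner_lin_transpose_right)

lemma lin_inner_commute: "lin_inner A B = lin_inner B A"
  by (simp add: lin_inner_eq_sum inner_commute)

lemma bounded_bilinear_lin_inner:
  "bounded_bilinear (lin_inner :: 'v::euclidean_space lin \<Rightarrow> 'v lin \<Rightarrow> real)"
proof
  fix A A' B B' :: "'v lin" and r :: real
  show "lin_inner (A + A') B = lin_inner A B + lin_inner A' B"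
    "lin_inner A (B + B') = lin_inner A B + lin_inner A B'"
    "lin_inner (r *\<^sub>R A) B = r *\<^sub>R lin_inner A B"
    "lin_inner A (r *\<^sub>R B) = r *\<^sub>R lin_inner A B"
    by (simp_all add: lin_inner_eq_sum blinfun.add_left blinfun.scaleR_left inner_add
        sum.distrib sum_distrib_left)
  \<comment> \<open>Basis vectors have norm one, so each of the \<open>DIM('v)\<close> summands is
    at most \<open>norm A * norm B\<close>.\<close>
  show "\<exists>K. \<forall>A B. norm (lin_inner A B :: real) \<le> norm (A :: 'v lin) * norm B * K"
  proof (intro exI allI)
    fix A B :: "'v lin"
    have "\<bar>A b \<bullet> B b\<bar> \<le> norm A * norm B" if "b \<in> Basis" for b
    proof -
      have "norm (A b) \<le> norm A" "norm (B b) \<le> norm B"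
        using norm_blinfun[of A b] norm_blinfun[of B b] that by simp_all
      then have "norm (A b) * norm (B b) \<le> norm A * norm B"
        by (intro mult_mono) auto
      then show ?thesis using Cauchy_Schwarz_ineq2[of "A b" "B b"] by linarith
    qed
    then show "norm (lin_inner A B) \<le> norm A * norm B * DIM('v)"
      unfolding lin_inner_eq_sum real_norm_def
      by (intro order_trans[OF sum_abs] order_trans[OF sum_bounded_above]) auto
  qed
qed

interpretation lin_inner: bounded_bilinear lin_inner
  by (rule bounded_bilinear_lin_inner)

lemma lin_inner_pos: "A \<noteq> 0 \<Longrightarrow> 0 < lin_inner A A"
proof -
  assume "A \<noteq> 0"
  then obtain b where b: "b \<in> Basis" "A b \<noteq> 0"
    by (metis blinfun_euclidean_eqI blinfun.zero_left)
  then show ?thesis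
    unfolding lin_inner_eq_sum by (intro sum_pos2[of _ b]) auto
qed

text \<open>Both sides sum the products of corresponding matrix entries; only the order of summation
  differs.\<close>

lemma lin_inner_transpose: "lin_inner (lin_transpose A) (lin_transpose B) = lin_inner A B"
proof -
  have "lin_inner (lin_transpose A) (lin_transpose B)
      = (\<Sum>b\<in>Basis. \<Sum>c\<in>Basis. (A c \<bullet> b) * (B c \<bullet> b))"
    unfolding lin_inner_eq_sum
  proof (rule sum.cong[OF refl])
    fix b :: 'a
    show "lin_transpose A b \<bullet> lin_transpose B b = (\<Sum>c\<in>Basis. (A c \<bullet> b) * (B c \<bullet> b))"
      by (subst euclidean_inner, simp only: inner_lin_transpose_left) (simp add: inner_commute)
  qed
  also have "\<dots> = lin_inner A B"
    unfolding lin_inner_eq_sum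
    by (subst sum.swap, intro sum.cong refl) (rule euclidean_inner[symmetric])
  finally show ?thesis .
qed

lemma lin_inner_compose_left: "lin_inner A (B o\<^sub>L C) = lin_inner (lin_transpose B o\<^sub>L A) C"
  by (simp add: lin_inner_eq_sum inner_lin_transpose_left)

text \<open>Transposing both arguments turns right multiplication into left multiplication, whose
  adjoint is already known.\<close>

lemma lin_inner_compose_right: "lin_inner A (B o\<^sub>L C) = lin_inner (A o\<^sub>L lin_transpose C) B"
  by (subst (1 2) lin_inner_transpose[symmetric])
    (simp add: lin_transpose_compose lin_inner_compose_left)

section \<open>Square roots and the Nesterov--Todd scaling\<close>

lemma Sym_max_eigenvector:
  fixes A :: "'v::euclidean_space lin"
  assumes "A \<in> Sym"
  obtains l e where "norm e = 1" "A e = l *\<^sub>R e" "\<And>x. x \<bullet> A x \<le> l * (x \<bullet> x)"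
proof -
  have "(UNIV :: 'v set) \<noteq> {0}"
    by (metis UNIV_I nonempty_Basis nonzero_Basis ex_in_conv singletonD)
  then obtain l h where h: "h \<noteq> 0" "A h = l *\<^sub>R h" "\<And>x. x \<bullet> A x \<le> l * (x \<bullet> x)"
    using self_adjoint_max_eigenvalue[of UNIV "(\<bullet>)" "blinfun_apply A"]
    by (metis SymD[OF assms] UNIV_I bounded_bilinear_inner blinfun.bounded_linear_right
        closed_UNIV inner_commute inner_gt_zero_iff subspace_UNIV)
  show ?thesis
    by (rule that[of "(1 / norm h) *\<^sub>R h" l]) (use h in \<open>simp_all add: blinfun.scaleR_right\<close>)
qed

section \<open>Positive semidefinite operators and their square roots\<close>

lemma Sym_psdD:
  assumes "A \<in> Sym_psd"
  shows "A \<in> Sym" "0 \<le> v \<bullet> A v"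
  using assms by (auto simp: Sym_psd_def)

lemma Sym_pd_imp_psd: "A \<in> Sym_pd \<Longrightarrow> A \<in> Sym_psd"
  by (auto simp: Sym_pd_def Sym_psd_def) (metis inner_zero_left less_eq_real_def)

text \<open>The quadratic form attains its minimum \<open>0\<close> at \<open>v\<close>, so its
  first variation in the direction \<open>A v\<close> vanishes; up to a factor this variation is the
  squared norm of \<open>A v\<close>.\<close>

lemma Sym_psd_kernel:
  assumes A: "A \<in> Sym_psd" and v: "v \<bullet> A v = 0"
  shows "A v = 0"
proof -
  define y where "y = A v"
  have "0 \<le> 2 * t * (y \<bullet> A v) + t^2 * (y \<bullet> A y)" for t
  proof -
    have "0 \<le> (v + t *\<^sub>R y) \<bullet> A (v + t *\<^sub>R y)" using A by (rule Sym_psdD)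
    also have "\<dots> = 2 * t * (y \<bullet> A v) + t^2 * (y \<bullet> A y)"
      using v SymD[OF Sym_psdD(1)[OF A], of v y]
      by (simp add: blinfun.add_right blinfun.scaleR_right inner_add algebra_simps
          power2_eq_square inner_commute)
    finally show ?thesis .
  qed
  then have "y \<bullet> A v = 0" by (rule linear_coefficient_zero_if_quadratic_nonneg)
  then show ?thesis by (simp add: y_def)
qed

text \<open>Since \<open>B (B - C) + (B - C) C = 0\<close>, an eigenvector \<open>e\<close> of \<open>B - C\<close> with eigenvalue \<open>l\<close>
  satisfies \<open>l * (e \<bullet> B e + e \<bullet> C e) = 0\<close>, which forces \<open>l = 0\<close>.\<close>

lemma Sym_psd_square_eq_imp_le:
  fixes B C :: "'v::euclidean_space lin"
  assumes B: "B \<in> Sym_psd" and C: "C \<in> Sym_psd" and eq: "B o\<^sub>L B = C o\<^sub>L C"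
  shows "x \<bullet> B x \<le> x \<bullet> C x"
proof -
  have "B - C \<in> Sym"
    using B C by (simp add: Sym_psdD(1) subspace_Sym subspace_diff)
  then obtain l e where e: "norm e = 1" "(B - C) e = l *\<^sub>R e"
      "\<And>x. x \<bullet> (B - C) x \<le> l * (x \<bullet> x)"
    using Sym_max_eigenvector by blast
  have "B (B e) = C (C e)" using arg_cong[OF eq, of "\<lambda>T. blinfun_apply T e"] by simp
  moreover have de: "B e = C e + l *\<^sub>R e" using e(2) by (simp add: blinfun.diff_left algebra_simps)
  moreover have "e \<bullet> B (B e) = B e \<bullet> B e" "e \<bullet> C (C e) = C e \<bullet> C e"
    using SymD[OF Sym_psdD(1)[OF B]] SymD[OF Sym_psdD(1)[OF C]] by auto
  ultimately have "B e \<bullet> B e = C e \<bullet> C e" by simp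
  then have "(B e - C e) \<bullet> (B e + C e) = 0"
    by (simp add: inner_diff inner_add inner_commute)
  moreover have "B e - C e = l *\<^sub>R e" using de by simp
  ultimately have *: "l * (e \<bullet> B e + e \<bullet> C e) = 0"
    by (simp add: inner_add_right distrib_left)
  have "l = 0"
  proof (rule ccontr)
    assume "l \<noteq> 0"
    then have "e \<bullet> B e = 0" "e \<bullet> C e = 0"
      using * Sym_psdD(2)[OF B, of e] Sym_psdD(2)[OF C, of e]
      by (simp_all add: add_nonneg_eq_0_iff)
    then have "B e = 0" "C e = 0" using B C by (auto intro: Sym_psd_kernel)
    then show False using de \<open>l \<noteq> 0\<close> e(1) by auto
  qed
  then show ?thesis using e(3)[of x] by (simp add: blinfun.diff_left inner_diff_right)
qed

text \<open>Comparison in both directions makes the quadratic form of \<open>B - C\<close> vanish.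
  Then \<open>B - C\<close> is itself positive semidefinite and every vector lies in its
  kernel.\<close>

lemma Sym_psd_square_unique:
  assumes B: "B \<in> Sym_psd" and C: "C \<in> Sym_psd" and eq: "B o\<^sub>L B = C o\<^sub>L C"
  shows "B = C"
proof -
  have "x \<bullet> (B - C) x = 0" for x
    using Sym_psd_square_eq_imp_le[OF B C eq, of x] Sym_psd_square_eq_imp_le[OF C B eq[symmetric], of x]
    by (simp add: blinfun.diff_left inner_diff_right)
  moreover from this have "B - C \<in> Sym_psd"
    using B C by (simp add: Sym_psd_def subspace_Sym subspace_diff)
  ultimately have "(B - C) x = 0" for x by (intro Sym_psd_kernel) auto
  then show ?thesis by (intro blinfun_eqI) (simp add: blinfun.diff_left)
qed

text \<open>Deflation: subtracting \<open>l\<close> times the projection onto a top eigenvector \<open>e\<close> lowers the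
  rank, and a root \<open>B\<close> of the remainder satisfies \<open>B e = 0\<close>.\<close>

lemma Sym_psd_square_root_exists:
  fixes A :: "'v::euclidean_space lin"
  assumes "A \<in> Sym_psd"
  shows "\<exists>B\<in>Sym_psd. B o\<^sub>L B = A"
  using assms
proof (induction "dim (range (blinfun_apply A))" arbitrary: A rule: less_induct)
  case less
  note A = Sym_psdD[OF less.prems]
  show ?case
  proof (cases "A = 0")
    case True
    then show ?thesis by (intro bexI[of _ 0]) (use less.prems in auto)
  next
    case False
    obtain l e where e: "norm e = 1" "A e = l *\<^sub>R e" "\<And>x. x \<bullet> A x \<le> l * (x \<bullet> x)"
      using Sym_max_eigenvector[OF A(1)] by blast
    have ee: "e \<bullet> e = 1" using e(1) by (simp add: dot_square_norm)
    have "l > 0"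
    proof (rule ccontr)
      assume "\<not> l > 0"
      then have "x \<bullet> A x = 0" for x
        using e(3)[of x] A(2)[of x] mult_nonpos_nonneg[of l "x \<bullet> x"] by simp
      then have "A x = 0" for x using less.prems Sym_psd_kernel by blast
      then show False using False by (simp add: blinfun_eqI)
    qed
    \<comment> \<open>The orthogonal projection onto the line spanned by \<open>e\<close>.\<close>
    define E where "E = blinfun_scaleR_left e o\<^sub>L blinfun_inner_left e"
    have E: "E x = (x \<bullet> e) *\<^sub>R e" for x by (simp add: E_def inner_commute)
    define A' where "A' = A - l *\<^sub>R E"
    have A': "A' x = A x - (l * (x \<bullet> e)) *\<^sub>R e" for x
      by (simp add: A'_def E blinfun.diff_left blinfun.scaleR_left)
    have Ae: "A x \<bullet> e = l * (x \<bullet> e)" for x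
      using SymD[OF A(1), of x e] e(2) by simp
    have "A' \<in> Sym"
      using SymD[OF A(1)] by (simp add: Sym_iff A' inner_diff inner_commute)
    moreover have "0 \<le> x \<bullet> A' x" for x
    proof -
      \<comment> \<open>The form of \<open>A'\<close> at \<open>x\<close> is the form of
        \<open>A\<close> at the component of \<open>x\<close> orthogonal to
        \<open>e\<close>.\<close>
      have "0 \<le> (x - (x \<bullet> e) *\<^sub>R e) \<bullet> A (x - (x \<bullet> e) *\<^sub>R e)" by (rule A(2))
      also have "\<dots> = x \<bullet> A' x"
        using Ae[of x] ee
        by (simp add: A' e(2) blinfun.diff_right blinfun.scaleR_right inner_diff inner_commute
            algebra_simps)
      finally show ?thesis .
    qed
    ultimately have A'psd: "A' \<in> Sym_psd" by (simp add: Sym_psd_def)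
    \<comment> \<open>The range of \<open>A'\<close> lies in that of \<open>A\<close> and is
      orthogonal to \<open>e\<close>, whereas \<open>e\<close> belongs to the range of
      \<open>A\<close>. The inclusion is therefore strict and the dimension drops.\<close>
    have "A' x = A (x - (x \<bullet> e) *\<^sub>R e)" for x
      by (simp add: A' e(2) blinfun.diff_right blinfun.scaleR_right mult.commute)
    then have "range (blinfun_apply A') \<subseteq> range (blinfun_apply A)" by auto
    moreover have "e = A ((1 / l) *\<^sub>R e)"
      using \<open>l > 0\<close> by (simp add: e(2) blinfun.scaleR_right)
    then have "e \<in> range (blinfun_apply A)" by (rule range_eqI)
    moreover have "A' x \<bullet> e = 0" for x
      using Ae[of x] ee by (simp add: A' inner_diff_left)
    then have "e \<notin> range (blinfun_apply A')" using ee by force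
    moreover have "span (range (blinfun_apply T)) = range (blinfun_apply T)" for T :: "'v lin"
      by (intro span_eq_iff[THEN iffD2] linear_subspace_image subspace_UNIV)
        (simp add: blinfun.bounded_linear_right bounded_linear.linear)
    ultimately have "dim (range (blinfun_apply A')) < dim (range (blinfun_apply A))"
      by (intro dim_psubset) (simp only: psubset_eq, blast)
    then obtain B where B: "B \<in> Sym_psd" "B o\<^sub>L B = A'"
      using less.hyps A'psd by blast
    have BB: "B (B x) = A' x" for x using B(2) by (metis blinfun_apply_blinfun_compose)
    have "B e \<bullet> B e = e \<bullet> A' e"
      using SymD[OF Sym_psdD(1)[OF B(1)], of e "B e"] BB by simp
    then have Be: "B e = 0" using ee e(2) by (simp add: A')
    have eB: "B x \<bullet> e = 0" for x
      using SymD[OF Sym_psdD(1)[OF B(1)], of x e] Be by simp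
    \<comment> \<open>Because \<open>B e = 0\<close> and the range of \<open>B\<close> is orthogonal
      to \<open>e\<close>, the mixed terms of the square of \<open>R\<close> vanish, leaving
      \<open>A' + l *\<^sub>R E = A\<close>.\<close>
    define R where "R = B + sqrt l *\<^sub>R E"
    have R: "R x = B x + (sqrt l * (x \<bullet> e)) *\<^sub>R e" for x
      by (simp add: R_def E blinfun.add_left blinfun.scaleR_left)
    have "R \<in> Sym"
      using SymD[OF Sym_psdD(1)[OF B(1)]] by (simp add: Sym_iff R inner_add inner_commute)
    moreover have "0 \<le> x \<bullet> R x" for x
      using Sym_psdD(2)[OF B(1), of x] \<open>l > 0\<close>
      by (simp add: R inner_add_right mult.assoc)
    moreover have "R (R x) = A x" for x
      using \<open>l > 0\<close> ee
      by (simp add: R BB A' blinfun.add_right blinfun.scaleR_right Be eB inner_add_left)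
    ultimately show ?thesis
      by (intro bexI[of _ R]) (auto simp: Sym_psd_def intro: blinfun_eqI)
  qed
qed

text \<open>Existence and uniqueness of the root make the definite description in
  \<open>lin_sqrt\<close> meaningful.\<close>

lemma
  assumes "A \<in> Sym_psd"
  shows lin_sqrt_Sym_psd: "lin_sqrt A \<in> Sym_psd"
    and lin_sqrt_square: "lin_sqrt A o\<^sub>L lin_sqrt A = A"
proof -
  have "\<exists>!B. B \<in> Sym_psd \<and> B o\<^sub>L B = A"
    using Sym_psd_square_root_exists[OF assms] Sym_psd_square_unique by metis
  from theI'[OF this] show "lin_sqrt A \<in> Sym_psd" "lin_sqrt A o\<^sub>L lin_sqrt A = A"
    by (simp_all add: lin_sqrt_def)
qed

lemma lin_sqrt_scaled_id:
  assumes "0 \<le> c"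
  shows "lin_sqrt (c *\<^sub>R id_blinfun) = sqrt c *\<^sub>R id_blinfun"
proof -
  have psd: "d *\<^sub>R id_blinfun \<in> Sym_psd" if "0 \<le> d" for d
    using that by (simp add: Sym_psd_def Sym_scaleR id_blinfun_Sym blinfun.scaleR_left)
  show ?thesis
  proof (rule Sym_psd_square_unique)
    show "lin_sqrt (c *\<^sub>R id_blinfun) o\<^sub>L lin_sqrt (c *\<^sub>R id_blinfun)
        = (sqrt c *\<^sub>R id_blinfun) o\<^sub>L (sqrt c *\<^sub>R id_blinfun)"
      unfolding lin_sqrt_square[OF psd[OF assms]]
      by (rule blinfun_eqI) (simp add: blinfun.scaleR_left assms)
  qed (use assms in \<open>auto intro: psd lin_sqrt_Sym_psd\<close>)
qed

section \<open>Inverses, and the scaling point on the central path\<close>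

lemma lin_inverse_scaled_id:
  assumes "c \<noteq> 0"
  shows "lin_inverse (c *\<^sub>R id_blinfun) = (1 / c) *\<^sub>R id_blinfun"
  unfolding lin_inverse_def
proof (rule the_equality)
  fix B assume "c *\<^sub>R id_blinfun o\<^sub>L B = id_blinfun \<and> B o\<^sub>L c *\<^sub>R id_blinfun = id_blinfun"
  then have "c *\<^sub>R B x = x" for x
    by (metis blinfun.scaleR_left blinfun_apply_blinfun_compose id_blinfun.rep_eq)
  then show "B = (1 / c) *\<^sub>R id_blinfun"
    using assms by (intro blinfun_eqI) (metis blinfun.scaleR_left divide_inverse id_blinfun.rep_eq
        inverse_eq_divide left_inverse mult_1 scaleR_one scaleR_scaleR)
qed (use assms in \<open>auto intro!: blinfun_eqI simp: blinfun.scaleR_left blinfun.scaleR_right\<close>)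

lemma blinfun_right_inverse_imp_left_inverse:
  fixes A B :: "'v::euclidean_space lin"
  assumes "A o\<^sub>L B = id_blinfun"
  shows "B o\<^sub>L A = id_blinfun"
proof -
  have "blinfun_apply A \<circ> blinfun_apply B = id"
    using arg_cong[OF assms, of blinfun_apply] by (auto simp: fun_eq_iff)
  then have "blinfun_apply B \<circ> blinfun_apply A = id"
    using linear_inverse_left[of "blinfun_apply A" "blinfun_apply B"]
    by (simp add: blinfun.bounded_linear_right bounded_linear.linear)
  then show ?thesis by (intro blinfun_eqI) (simp add: fun_eq_iff)
qed

text \<open>After division by \<open>c\<close>, one factor is a right inverse of the other, and in
  finite dimension it is then also a left inverse.\<close>

lemma blinfun_compose_eq_scaled_id_commute:
  fixes A B :: "'v::euclidean_space lin"
  assumes "A o\<^sub>L B = c *\<^sub>R id_blinfun" "c \<noteq> 0"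
  shows "B o\<^sub>L A = c *\<^sub>R id_blinfun"
proof -
  have "A o\<^sub>L (1 / c) *\<^sub>R B = id_blinfun"
    using assms by (simp add: bounded_bilinear.scaleR_right[OF bounded_bilinear_blinfun_compose])
  then have "(1 / c) *\<^sub>R B o\<^sub>L A = id_blinfun"
    by (rule blinfun_right_inverse_imp_left_inverse)
  then have "c *\<^sub>R ((1 / c) *\<^sub>R (B o\<^sub>L A)) = c *\<^sub>R id_blinfun"
    by (simp add: bounded_bilinear.scaleR_left[OF bounded_bilinear_blinfun_compose])
  then show ?thesis using assms(2) by simp
qed

text \<open>With \<open>Y\<close> the root of \<open>X\<close>, the factors \<open>Y\<close> and
  \<open>Y S\<close> have a scalar product operator and hence commute. So \<open>Y S Y\<close>
  equals \<open>\<nu>\<close> times the identity, and the inverse root in the middle of the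
  geometric mean is a scalar.\<close>

lemma NT_scaling_central_path:
  assumes X: "X \<in> Sym_psd" and XS: "X o\<^sub>L S = \<nu> *\<^sub>R id_blinfun" and \<nu>: "0 < \<nu>"
  shows "NT_scaling X S = (1 / sqrt \<nu>) *\<^sub>R X"
proof -
  define Y where "Y = lin_sqrt X"
  have YY: "Y o\<^sub>L Y = X" unfolding Y_def by (rule lin_sqrt_square[OF X])
  have "Y o\<^sub>L (Y o\<^sub>L S) = \<nu> *\<^sub>R id_blinfun"
    unfolding XS[symmetric] YY[symmetric] by (rule blinfun_eqI) simp
  then have "Y o\<^sub>L S o\<^sub>L Y = \<nu> *\<^sub>R id_blinfun"
    by (rule blinfun_compose_eq_scaled_id_commute) (use \<nu> in simp)
  then have "NT_scaling X S = Y o\<^sub>L (1 / sqrt \<nu>) *\<^sub>R id_blinfun o\<^sub>L Y"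
    using \<nu> by (simp add: NT_scaling_def Y_def[symmetric] lin_sqrt_scaled_id lin_inverse_scaled_id)
  also have "\<dots> = (1 / sqrt \<nu>) *\<^sub>R X"
    unfolding YY[symmetric]
    by (rule blinfun_eqI) (simp add: blinfun.scaleR_left blinfun.scaleR_right)
  finally show ?thesis .
qed

text \<open>Turns a Frobenius norm into values of the quadratic form of the square of
  \<open>Y\<close>, so that bounds on that form apply column by column.\<close>

lemma lin_inner_Sym_compose:
  assumes "Y \<in> Sym"
  shows "lin_inner (Y o\<^sub>L A) (Y o\<^sub>L A) = (\<Sum>b\<in>Basis. A b \<bullet> (Y o\<^sub>L Y) (A b))"
  by (simp add: lin_inner_eq_sum SymD[OF assms])

text \<open>With \<open>Y\<close> the square root of \<open>X\<close>, both sides are squared Frobenius norms: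
  \<open>lin_inner H (X H X)\<close> is that of \<open>Y H Y\<close>, and the two factors \<open>Y\<close> are estimated one at a time.\<close>

lemma
  assumes X: "X \<in> Sym_psd" and H: "H \<in> Sym" and c: "0 \<le> c"
  shows lin_inner_congruence_lower:
      "(\<And>v. c * (v \<bullet> v) \<le> v \<bullet> X v) \<Longrightarrow> c^2 * lin_inner H H \<le> lin_inner H (X o\<^sub>L H o\<^sub>L X)"
    and lin_inner_congruence_upper:
      "(\<And>v. v \<bullet> X v \<le> c * (v \<bullet> v)) \<Longrightarrow> lin_inner H (X o\<^sub>L H o\<^sub>L X) \<le> c^2 * lin_inner H H"
proof -
  define Y where "Y = lin_sqrt X"
  have Y: "Y \<in> Sym" unfolding Y_def by (rule Sym_psdD lin_sqrt_Sym_psd X)+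
  have YY: "Y o\<^sub>L Y = X" unfolding Y_def by (rule lin_sqrt_square[OF X])
  have Yt: "lin_transpose Y = Y" and Ht: "lin_transpose H = H" using Y H by (auto simp: Sym_def)
  have "X o\<^sub>L H o\<^sub>L X = Y o\<^sub>L (Y o\<^sub>L H o\<^sub>L Y o\<^sub>L Y)"
    unfolding YY[symmetric] by (rule blinfun_eqI) simp
  then have "lin_inner H (X o\<^sub>L H o\<^sub>L X) = lin_inner (Y o\<^sub>L H) (Y o\<^sub>L H o\<^sub>L Y o\<^sub>L Y)"
    by (simp only: lin_inner_compose_left Yt)
  also have "\<dots> = lin_inner (Y o\<^sub>L H o\<^sub>L Y) (Y o\<^sub>L H o\<^sub>L Y)"
    by (subst lin_inner_compose_right) (simp only: Yt)
  also have "Y o\<^sub>L H o\<^sub>L Y = Y o\<^sub>L (H o\<^sub>L Y)" by (rule blinfun_eqI) simp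
  finally have 1: "lin_inner H (X o\<^sub>L H o\<^sub>L X) = (\<Sum>b\<in>Basis. (H o\<^sub>L Y) b \<bullet> X ((H o\<^sub>L Y) b))"
    by (simp only: lin_inner_Sym_compose[OF Y] YY)
  \<comment> \<open>Transposition preserves the norm and exchanges \<open>H Y\<close> with
    \<open>Y H\<close>, so the second factor \<open>Y\<close> can be estimated like the
    first.\<close>
  have "lin_inner (H o\<^sub>L Y) (H o\<^sub>L Y) = lin_inner (Y o\<^sub>L H) (Y o\<^sub>L H)"
    by (subst lin_inner_transpose[symmetric]) (simp add: lin_transpose_compose Yt Ht)
  then have 2: "lin_inner (H o\<^sub>L Y) (H o\<^sub>L Y) = (\<Sum>b\<in>Basis. H b \<bullet> X (H b))"
    by (simp only: lin_inner_Sym_compose[OF Y] YY)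
  {
    assume le: "c * (v \<bullet> v) \<le> v \<bullet> X v" for v
    have *: "c * lin_inner A A \<le> (\<Sum>b\<in>Basis. A b \<bullet> X (A b))" for A :: "'a lin"
      unfolding lin_inner_eq_sum sum_distrib_left by (intro sum_mono le)
    have "c^2 * lin_inner H H = c * (c * lin_inner H H)" by (simp add: power2_eq_square)
    also have "\<dots> \<le> c * lin_inner (H o\<^sub>L Y) (H o\<^sub>L Y)"
      unfolding 2 by (intro mult_left_mono * c)
    also have "\<dots> \<le> lin_inner H (X o\<^sub>L H o\<^sub>L X)" unfolding 1 by (rule *)
    finally show "c^2 * lin_inner H H \<le> lin_inner H (X o\<^sub>L H o\<^sub>L X)" .
  }
  {
    assume le: "v \<bullet> X v \<le> c * (v \<bullet> v)" for v
    have *: "(\<Sum>b\<in>Basis. A b \<bullet> X (A b)) \<le> c * lin_inner A A" for A :: "'a lin"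
      unfolding lin_inner_eq_sum sum_distrib_left by (intro sum_mono le)
    have "lin_inner H (X o\<^sub>L H o\<^sub>L X) \<le> c * lin_inner (H o\<^sub>L Y) (H o\<^sub>L Y)"
      unfolding 1 by (rule *)
    also have "\<dots> \<le> c * (c * lin_inner H H)"
      unfolding 2 by (intro mult_left_mono * c)
    also have "\<dots> = c^2 * lin_inner H H" by (simp add: power2_eq_square)
    finally show "lin_inner H (X o\<^sub>L H o\<^sub>L X) \<le> c^2 * lin_inner H H" .
  }
qed

section \<open>Fourth-order tensors and their condition numbers\<close>

text \<open>A fourth-order tensor is constrained only on \<open>Sym\<close>; composed with \<open>sym_part\<close> it is linear on
  the whole type, so the facts about linear maps apply.\<close>

definition sym_part :: "'v::euclidean_space lin \<Rightarrow> 'v lin" where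
  "sym_part A = (1/2) *\<^sub>R (A + lin_transpose A)"

lemma sym_part_in_Sym: "sym_part A \<in> Sym"
  by (simp add: sym_part_def Sym_def linear_cmul[OF linear_lin_transpose]
      linear_add[OF linear_lin_transpose] add.commute)

lemma sym_part_Sym [simp]: "A \<in> Sym \<Longrightarrow> sym_part A = A"
  by (simp add: sym_part_def Sym_def flip: scaleR_2)

lemma linear_sym_part: "linear sym_part"
  by (intro linearI)
    (simp_all add: sym_part_def linear_cmul[OF linear_lin_transpose]
      linear_add[OF linear_lin_transpose] algebra_simps)

lemma fourth_order_tensorD:
  assumes "fourth_order_tensor T" "A \<in> Sym"
  shows "T A \<in> Sym" "B \<in> Sym \<Longrightarrow> T (A + B) = T A + T B" "T (c *\<^sub>R A) = c *\<^sub>R T A"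
  using assms by (auto simp: fourth_order_tensor_def)

lemma fourth_order_tensor_zero:
  "fourth_order_tensor T \<Longrightarrow> T 0 = 0"
  using fourth_order_tensorD(3)[of T 0 0] by (simp add: subspace_0[OF subspace_Sym])

lemma fourth_order_tensor_uminus:
  "fourth_order_tensor T \<Longrightarrow> fourth_order_tensor (\<lambda>H. - T H)"
  by (auto simp: fourth_order_tensor_def subspace_Sym subspace_neg)

lemma linear_tensor_sym_part:
  assumes "fourth_order_tensor T"
  shows "linear (\<lambda>A. T (sym_part A))"
  by (intro linearI)
    (simp_all add: linear_add[OF linear_sym_part] linear_cmul[OF linear_sym_part]
      fourth_order_tensorD[OF assms] sym_part_in_Sym)

text \<open>The Rayleigh quotient argument on the closed subspace \<open>Sym\<close>, applied to the
  linear extension of \<open>T\<close> through \<open>sym_part\<close>.\<close>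

lemma tensor_max_eigenvalue:
  fixes T :: "'v::euclidean_space lin \<Rightarrow> 'v lin"
  assumes T: "fourth_order_tensor T" "tensor_symmetric T"
  obtains l where "l \<in> tensor_eigenvalues T"
    "\<And>H. H \<in> Sym \<Longrightarrow> lin_inner H (T H) \<le> l * lin_inner H H"
proof -
  define T' where "T' A = T (sym_part A)" for A
  have T': "T' A = T A" if "A \<in> Sym" for A using that by (simp add: T'_def)
  have "bounded_linear T'"
    unfolding T'_def by (intro linear_blinfun_imp_bounded_linear linear_tensor_sym_part T)
  moreover have "T' A \<in> Sym" if "A \<in> Sym" for A
    using that by (simp add: T' fourth_order_tensorD[OF T(1)])
  moreover have "lin_inner A (T' B) = lin_inner B (T' A)" if "A \<in> Sym" "B \<in> Sym" for A B
    using that T(2) by (simp add: T' tensor_symmetric_def)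
  ultimately obtain l H where "H \<in> Sym" "H \<noteq> 0" "T' H = l *\<^sub>R H"
      and le: "\<And>H. H \<in> Sym \<Longrightarrow> lin_inner H (T' H) \<le> l * lin_inner H H"
    using self_adjoint_max_eigenvalue[OF subspace_Sym closed_Sym Sym_nontrivial
        bounded_bilinear_lin_inner lin_inner_commute lin_inner_pos]
    by metis
  then have "l \<in> tensor_eigenvalues T" by (auto simp: tensor_eigenvalues_def T')
  then show ?thesis using that[of l] le by (simp add: T')
qed

text \<open>The least eigenvalue of \<open>T\<close> is the negative of the greatest eigenvalue of
  its negative.\<close>

lemma tensor_min_eigenvalue:
  fixes T :: "'v::euclidean_space lin \<Rightarrow> 'v lin"
  assumes T: "fourth_order_tensor T" "tensor_symmetric T"
  obtains l where "l \<in> tensor_eigenvalues T"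
    "\<And>H. H \<in> Sym \<Longrightarrow> l * lin_inner H H \<le> lin_inner H (T H)"
proof -
  have "tensor_symmetric (\<lambda>H. - T H)"
    using T(2) by (simp add: tensor_symmetric_def lin_inner.minus_right)
  then obtain l where l: "l \<in> tensor_eigenvalues (\<lambda>H. - T H)"
      "\<And>H. H \<in> Sym \<Longrightarrow> lin_inner H (- T H) \<le> l * lin_inner H H"
    using tensor_max_eigenvalue fourth_order_tensor_uminus[OF T(1)] by blast
  then obtain H where "H \<in> Sym" "H \<noteq> 0" "- T H = l *\<^sub>R H"
    by (auto simp: tensor_eigenvalues_def)
  moreover from this have "T H = (- l) *\<^sub>R H"
    by (metis minus_minus scaleR_minus_left)
  ultimately have "- l \<in> tensor_eigenvalues T"
    unfolding tensor_eigenvalues_def by blast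
  then show ?thesis using that[of "- l"] l(2) by (force simp: lin_inner.minus_right)
qed

text \<open>Eigenvectors for distinct eigenvalues are orthogonal, hence independent, and a
  finite-dimensional space holds finitely many of them. Finiteness makes \<open>Max\<close> and
  \<open>Min\<close> in \<open>condition_number\<close> actual elements of the spectrum.\<close>

lemma finite_tensor_eigenvalues:
  fixes T :: "'v::euclidean_space lin \<Rightarrow> 'v lin"
  assumes T: "tensor_symmetric T"
  shows "finite (tensor_eigenvalues T)"
proof -
  \<comment> \<open>Selects one eigenvector for each eigenvalue.\<close>
  define h where "h l = (SOME H. H \<in> Sym \<and> H \<noteq> 0 \<and> T H = l *\<^sub>R H)" for l
  have h: "h l \<in> Sym" "h l \<noteq> 0" "T (h l) = l *\<^sub>R h l" if "l \<in> tensor_eigenvalues T" for l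
  proof -
    have "h l \<in> Sym \<and> h l \<noteq> 0 \<and> T (h l) = l *\<^sub>R h l"
      unfolding h_def by (rule someI_ex) (use that in \<open>auto simp: tensor_eigenvalues_def\<close>)
    then show "h l \<in> Sym" "h l \<noteq> 0" "T (h l) = l *\<^sub>R h l" by auto
  qed
  have orth: "lin_inner (h k) (h l) = 0"
    if k: "k \<in> tensor_eigenvalues T" and l: "l \<in> tensor_eigenvalues T" and "k \<noteq> l" for k l
  proof -
    have "lin_inner (h k) (T (h l)) = lin_inner (h l) (T (h k))"
      using T h(1)[OF k] h(1)[OF l] by (simp add: tensor_symmetric_def)
    then have "(l - k) * lin_inner (h k) (h l) = 0"
      using h[OF k] h[OF l] lin_inner_commute[of "h k" "h l"]
      by (simp add: lin_inner.scaleR_right algebra_simps)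
    then show ?thesis using \<open>k \<noteq> l\<close> by simp
  qed
  have inj: "inj_on h (tensor_eigenvalues T)"
  proof (rule inj_onI, rule ccontr)
    fix k l assume kl: "k \<in> tensor_eigenvalues T" "l \<in> tensor_eigenvalues T" "h k = h l" "k \<noteq> l"
    then show False using orth[of k l] lin_inner_pos[OF h(2)[OF kl(2)]] by simp
  qed
  have "independent (h ` tensor_eigenvalues T)"
    unfolding independent_explicit_finite_subsets
  proof (intro allI impI ballI)
    fix F u v
    assume F: "F \<subseteq> h ` tensor_eigenvalues T" "finite F" and 0: "(\<Sum>v\<in>F. u v *\<^sub>R v) = 0"
      and v: "v \<in> F"
    have "lin_inner v w = 0" if "w \<in> F - {v}" for w
    proof -
      have "v \<in> h ` tensor_eigenvalues T" "w \<in> h ` tensor_eigenvalues T"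
        using F(1) v that by auto
      then obtain k l where "k \<in> tensor_eigenvalues T" "l \<in> tensor_eigenvalues T" "v = h k" "w = h l"
        by blast
      then show ?thesis using orth[of k l] that by auto
    qed
    \<comment> \<open>Pairing the vanishing combination with \<open>v\<close> isolates the
      coefficient of \<open>v\<close>.\<close>
    then have "lin_inner v (\<Sum>w\<in>F. u w *\<^sub>R w) = u v * lin_inner v v"
      using F v by (simp add: lin_inner.sum_right lin_inner.scaleR_right lin_inner.add_right
          sum.remove[of F v])
    moreover have "v \<in> h ` tensor_eigenvalues T" using F(1) v by (rule subsetD)
    then have "lin_inner v v > 0" using h(2) by (auto intro: lin_inner_pos)
    ultimately show "u v = 0" by (simp add: 0 lin_inner.zero_right)
  qed
  moreover obtain F :: "'v lin set" where "finite F" "span F = UNIV"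
    using finite_span_blinfun .
  ultimately have "finite (h ` tensor_eigenvalues T)"
    using independent_span_bound by blast
  then show ?thesis using inj by (rule finite_imageD)
qed

text \<open>Each eigenvalue is the Rayleigh quotient of its eigenvector and so lies between
  \<open>a\<close> and \<open>b\<close>.\<close>

lemma condition_number_bound:
  fixes T :: "'v::euclidean_space lin \<Rightarrow> 'v lin"
  assumes T: "fourth_order_tensor T" "tensor_symmetric T" and a: "0 < a"
    and lower: "\<And>H. H \<in> Sym \<Longrightarrow> a * lin_inner H H \<le> lin_inner H (T H)"
    and upper: "\<And>H. H \<in> Sym \<Longrightarrow> lin_inner H (T H) \<le> b * lin_inner H H"
  shows "\<bar>condition_number T\<bar> \<le> b / a"
proof -
  let ?E = "tensor_eigenvalues T"
  have bounds: "a \<le> l \<and> l \<le> b" if "l \<in> ?E" for l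
  proof -
    obtain H where H: "H \<in> Sym" "H \<noteq> 0" "T H = l *\<^sub>R H"
      using \<open>l \<in> ?E\<close> by (auto simp: tensor_eigenvalues_def)
    then show ?thesis
      using lower[OF H(1)] upper[OF H(1)] lin_inner_pos[OF H(2)]
      by (simp add: lin_inner.scaleR_right)
  qed
  have "finite ?E" "?E \<noteq> {}"
    using T finite_tensor_eigenvalues tensor_max_eigenvalue by blast+
  then have "Max ?E \<in> ?E" "Min ?E \<in> ?E" by auto
  from bounds[OF this(1)] bounds[OF this(2)] have "a \<le> Max ?E" "Max ?E \<le> b" "a \<le> Min ?E" by auto
  then show ?thesis
    using a unfolding condition_number_def by (auto intro!: frac_le)
qed

text \<open>Positive definiteness leaves only \<open>0\<close> in the kernel, and on a
  finite-dimensional space injectivity gives surjectivity.\<close>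

lemma bij_betw_tensor:
  fixes C :: "'v::euclidean_space lin \<Rightarrow> 'v lin"
  assumes C: "fourth_order_tensor C" "tensor_pos_def C"
  shows "bij_betw C Sym Sym"
proof -
  have inj: "inj_on C Sym"
  proof (rule inj_onI)
    fix A B assume AB: "A \<in> Sym" "B \<in> Sym" "C A = C B"
    \<comment> \<open>The difference is written as a sum with a multiple because
      \<open>fourth_order_tensor\<close> speaks of sums and multiples.\<close>
    have "C (A + (-1) *\<^sub>R B) = C A + (-1) *\<^sub>R C B"
      using AB(1,2) by (simp only: fourth_order_tensorD[OF C(1)] Sym_scaleR)
    then have "C (A - B) = 0" using AB(3) by simp
    moreover have "A - B \<in> Sym" using AB subspace_Sym subspace_diff by blast
    ultimately show "A = B"
      using C(2) unfolding tensor_pos_def_def by (force simp: lin_inner.zero_right)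
  qed
  obtain F :: "'v lin set" where F: "finite F" "span F = UNIV"
    using finite_span_blinfun .
  have "(\<lambda>A. C (sym_part A)) ` Sym = Sym"
  proof (rule linear_injective_on_subspace_surjective[OF subspace_Sym _ F(1)])
    show "linear (\<lambda>A. C (sym_part A))" by (rule linear_tensor_sym_part[OF C(1)])
    show "inj_on (\<lambda>A. C (sym_part A)) Sym" using inj by (simp add: inj_on_def)
  qed (use F in \<open>auto intro: fourth_order_tensorD(1)[OF C(1)]\<close>)
  then have "C ` Sym = Sym" by simp
  then show ?thesis using inj by (simp add: bij_betw_def)
qed

text \<open>Each property of the inverse is the corresponding property of \<open>C\<close> read at
  the preimages of the arguments.\<close>

lemma
  fixes C :: "'v::euclidean_space lin \<Rightarrow> 'v lin"
  assumes C: "fourth_order_tensor C" "tensor_symmetric C" "tensor_pos_def C"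
  shows fourth_order_tensor_inverse: "fourth_order_tensor (tensor_inverse C)"
    and tensor_symmetric_inverse: "tensor_symmetric (tensor_inverse C)"
    and tensor_pos_def_inverse: "tensor_pos_def (tensor_inverse C)"
proof -
  note bij = bij_betw_tensor[OF C(1,3)]
  let ?R = "tensor_inverse C"
  have R: "?R H \<in> Sym" "C (?R H) = H" if "H \<in> Sym" for H
    using that bij unfolding tensor_inverse_def
    by (metis bij_betw_def inv_into_into, metis bij_betw_inv_into_right)
  have RC: "?R H = A" if "A \<in> Sym" "C A = H" for A H
    using that bij unfolding tensor_inverse_def by (metis bij_betw_inv_into_left)
  show "fourth_order_tensor ?R"
    unfolding fourth_order_tensor_def
    by (auto intro!: RC simp: R fourth_order_tensorD[OF C(1)] subspace_Sym subspace_add Sym_scaleR)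
  show "tensor_symmetric ?R"
    unfolding tensor_symmetric_def
  proof (intro ballI)
    fix A B :: "'v lin" assume AB: "A \<in> Sym" "B \<in> Sym"
    then have "lin_inner (?R A) (C (?R B)) = lin_inner (?R B) (C (?R A))"
      using C(2) R(1) by (simp add: tensor_symmetric_def)
    then show "lin_inner A (?R B) = lin_inner B (?R A)"
      by (simp add: R AB lin_inner_commute)
  qed
  show "tensor_pos_def ?R"
    unfolding tensor_pos_def_def
  proof (intro ballI impI)
    fix A :: "'v lin" assume A: "A \<in> Sym" "A \<noteq> 0"
    then have "?R A \<noteq> 0" using R(2)[OF A(1)] fourth_order_tensor_zero[OF C(1)] by auto
    then have "0 < lin_inner (?R A) (C (?R A))"
      using C(3) R(1)[OF A(1)] by (simp add: tensor_pos_def_def)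
    then show "0 < lin_inner A (?R A)" by (simp add: R A lin_inner_commute)
  qed
qed

text \<open>The constants are the extreme eigenvalues, positive because the form is positive at
  their eigenvectors.\<close>

lemma tensor_pos_def_bounds:
  assumes T: "fourth_order_tensor T" "tensor_symmetric T" "tensor_pos_def T"
  obtains a b where "0 < a" "0 < b" "\<And>H. H \<in> Sym \<Longrightarrow> a * lin_inner H H \<le> lin_inner H (T H)"
    "\<And>H. H \<in> Sym \<Longrightarrow> lin_inner H (T H) \<le> b * lin_inner H H"
proof -
  have pos: "0 < l" if "l \<in> tensor_eigenvalues T" for l
  proof -
    obtain H where H: "H \<in> Sym" "H \<noteq> 0" "T H = l *\<^sub>R H"
      using \<open>l \<in> tensor_eigenvalues T\<close> by (auto simp: tensor_eigenvalues_def)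
    then have "0 < l * lin_inner H H"
      using T(3) by (metis tensor_pos_def_def lin_inner.scaleR_right real_scaleR_def)
    then show ?thesis using lin_inner_pos[OF H(2)] by (simp add: zero_less_mult_iff)
  qed
  show ?thesis
    using tensor_min_eigenvalue[OF T(1,2)] tensor_max_eigenvalue[OF T(1,2)] pos that by metis
qed

section \<open>The Schur complement on the central path\<close>

lemma NT_schur_central_path:
  assumes X: "X \<in> Sym_psd" and XS: "X o\<^sub>L S = \<nu> *\<^sub>R id_blinfun" and \<nu>: "0 < \<nu>" and H: "H \<in> Sym"
  shows "NT_schur C X S H = (1 / \<nu>) *\<^sub>R (X o\<^sub>L H o\<^sub>L X) + tensor_inverse C H"
proof -
  \<comment> \<open>Symmetry of \<open>H\<close> reduces the symmetrized product to a congruence;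
    its two factors \<open>1 / sqrt \<nu>\<close> then combine to \<open>1 / \<nu>\<close>.\<close>
  have "sym_prod (NT_scaling X S) (NT_scaling X S) H
      = (1 / sqrt \<nu>) *\<^sub>R X o\<^sub>L H o\<^sub>L (1 / sqrt \<nu>) *\<^sub>R X"
    unfolding NT_scaling_central_path[OF X XS \<nu>]
    by (intro sym_prod_Sym Sym_scaleR Sym_psdD(1)[OF X] H)
  also have "\<dots> = (1 / \<nu>) *\<^sub>R (X o\<^sub>L H o\<^sub>L X)"
    using \<nu> by (intro blinfun_eqI) (simp add: blinfun.scaleR_left blinfun.scaleR_right)
  finally show ?thesis by (simp add: NT_schur_def)
qed

text \<open>The Rayleigh quotient of the congruence part lies between \<open>a^2 / \<nu>\<close> and
  \<open>b^2 / \<nu>\<close>, that of the inverse tensor between \<open>p\<close> and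
  \<open>q\<close>; the bounds add up. The case \<open>a = 0\<close> is allowed.\<close>

lemma NT_schur_condition_number_bound:
  fixes X :: "'a::euclidean_space lin"
  assumes C: "fourth_order_tensor C" "tensor_symmetric C" "tensor_pos_def C"
    and X: "X \<in> Sym_psd" and XS: "X o\<^sub>L S = \<nu> *\<^sub>R id_blinfun" and \<nu>: "0 < \<nu>"
    and a: "0 \<le> a" "\<And>v. a * (v \<bullet> v) \<le> v \<bullet> X v"
    and b: "0 \<le> b" "\<And>v. v \<bullet> X v \<le> b * (v \<bullet> v)"
    and p: "0 < p" "\<And>H. H \<in> Sym \<Longrightarrow> p * lin_inner H H \<le> lin_inner H (tensor_inverse C H)"
    and q: "\<And>H. H \<in> Sym \<Longrightarrow> lin_inner H (tensor_inverse C H) \<le> q * lin_inner H H"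
  shows "\<bar>condition_number (NT_schur C X S)\<bar> \<le> (b^2 / \<nu> + q) / (a^2 / \<nu> + p)"
proof (rule condition_number_bound)
  note N = NT_schur_central_path[OF X XS \<nu>, of _ C]
  note X' = Sym_psdD(1)[OF X]
  note R = fourth_order_tensor_inverse[OF C] tensor_symmetric_inverse[OF C]
  show "fourth_order_tensor (NT_schur C X S)"
    unfolding fourth_order_tensor_def
  proof (intro conjI ballI allI)
    fix A B :: "'a lin" assume AB: "A \<in> Sym" "B \<in> Sym"
    show "NT_schur C X S A \<in> Sym"
      using AB X' by (simp add: N Sym_compose_compose fourth_order_tensorD[OF R(1)] subspace_Sym
          subspace_add Sym_scaleR)
    show "NT_schur C X S (A + B) = NT_schur C X S A + NT_schur C X S B"
      using AB by (intro blinfun_eqI)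
        (simp add: N fourth_order_tensorD[OF R(1)] subspace_Sym subspace_add blinfun.bilinear_simps
          algebra_simps)
    show "NT_schur C X S (c *\<^sub>R A) = c *\<^sub>R NT_schur C X S A" for c
      using AB by (intro blinfun_eqI)
        (simp add: N fourth_order_tensorD[OF R(1)] Sym_scaleR blinfun.bilinear_simps algebra_simps)
  qed
  show "tensor_symmetric (NT_schur C X S)"
    unfolding tensor_symmetric_def
  proof (intro ballI)
    fix A B :: "'a lin" assume AB: "A \<in> Sym" "B \<in> Sym"
    have Xt: "lin_transpose X = X" using X' by (simp add: Sym_def)
    have "X o\<^sub>L B o\<^sub>L X = X o\<^sub>L (B o\<^sub>L X)" by (rule blinfun_eqI) simp
    then have "lin_inner A (X o\<^sub>L B o\<^sub>L X) = lin_inner (X o\<^sub>L A) (B o\<^sub>L X)"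
      by (simp only: lin_inner_compose_left Xt)
    also have "\<dots> = lin_inner (X o\<^sub>L A o\<^sub>L X) B"
      by (subst lin_inner_compose_right) (simp only: Xt)
    also have "\<dots> = lin_inner B (X o\<^sub>L A o\<^sub>L X)" by (rule lin_inner_commute)
    finally show "lin_inner A (NT_schur C X S B) = lin_inner B (NT_schur C X S A)"
      using R(2) AB by (simp add: N lin_inner.add_right lin_inner.scaleR_right tensor_symmetric_def)
  qed
  show "0 < a^2 / \<nu> + p" using p \<nu> by (simp add: add_nonneg_pos)
  fix H :: "'a lin" assume H: "H \<in> Sym"
  show "(a^2 / \<nu> + p) * lin_inner H H \<le> lin_inner H (NT_schur C X S H)"
    using divide_right_mono[OF lin_inner_congruence_lower[OF X H a], of \<nu>] p(2)[OF H] \<nu>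
    by (simp add: N H lin_inner.add_right lin_inner.scaleR_right algebra_simps)
  show "lin_inner H (NT_schur C X S H) \<le> (b^2 / \<nu> + q) * lin_inner H H"
    using divide_right_mono[OF lin_inner_congruence_upper[OF X H b], of \<nu>] q[OF H] \<nu>
    by (simp add: N H lin_inner.add_right lin_inner.scaleR_right algebra_simps)
qed

section \<open>The condition number along the central path\<close>

lemma inner_blinfun_le_norm: "\<bar>v \<bullet> blinfun_apply A v\<bar> \<le> norm A * (v \<bullet> v)"
proof -
  have "\<bar>v \<bullet> A v\<bar> \<le> norm v * (norm A * norm v)"
    by (intro order_trans[OF Cauchy_Schwarz_ineq2] mult_left_mono norm_blinfun norm_ge_zero)
  then show ?thesis by (simp add: dot_square_norm power2_eq_square mult_ac)
qed

text \<open>The constant is the least eigenvalue of \<open>A\<close>, obtained as minus the greatest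
  eigenvalue of \<open>- A\<close>.\<close>

lemma Sym_pd_lower_bound:
  assumes A: "A \<in> Sym_pd"
  obtains c where "0 < c" "\<And>v. c * (v \<bullet> v) \<le> v \<bullet> A v"
proof -
  have "- A \<in> Sym" using A by (simp add: Sym_pd_def subspace_Sym subspace_neg)
  then obtain l e where e: "norm e = 1" "(- A) e = l *\<^sub>R e" "\<And>x. x \<bullet> (- A) x \<le> l * (x \<bullet> x)"
    using Sym_max_eigenvector by blast
  have "e \<noteq> 0" using e(1) by auto
  then have "0 < e \<bullet> A e" using A by (simp add: Sym_pd_def)
  moreover have "e \<bullet> (- A) e = l" using e(1,2) by (simp add: dot_square_norm)
  ultimately have "0 < - l" by (simp add: blinfun.minus_left)
  moreover have "- l * (x \<bullet> x) \<le> x \<bullet> A x" for x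
    using e(3)[of x] by (simp add: blinfun.minus_left)
  ultimately show ?thesis by (rule that)
qed

text \<open>A perturbation of operator norm below half the lower bound of the limit leaves the other
  half intact.\<close>

lemma Sym_pd_eventually_lower_bound:
  fixes A :: "'v::euclidean_space lin"
  assumes A: "A \<in> Sym_pd" and lim: "(B \<longlongrightarrow> A) F"
  obtains c where "0 < c" "\<forall>\<^sub>F k in F. \<forall>v. c * (v \<bullet> v) \<le> v \<bullet> blinfun_apply (B k) v"
proof -
  obtain c where c: "0 < c" "\<And>v. c * (v \<bullet> v) \<le> v \<bullet> A v"
    using Sym_pd_lower_bound[OF A] by blast
  have "\<forall>\<^sub>F k in F. dist (B k) A < c / 2" using lim c(1) by (intro tendstoD) auto
  then have "\<forall>\<^sub>F k in F. \<forall>v. c / 2 * (v \<bullet> v) \<le> v \<bullet> blinfun_apply (B k) v"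
  proof (rule eventually_mono, intro allI)
    fix k and v :: 'v assume "dist (B k) A < c / 2"
    then have "norm (B k - A) * (v \<bullet> v) \<le> c / 2 * (v \<bullet> v)"
      by (intro mult_right_mono) (auto simp: dist_norm)
    then show "c / 2 * (v \<bullet> v) \<le> v \<bullet> blinfun_apply (B k) v"
      using inner_blinfun_le_norm[of v "B k - A"] c(2)[of v]
      by (simp add: blinfun.diff_left inner_diff_right)
  qed
  then show ?thesis using that[of "c / 2"] c(1) by simp
qed

text \<open>Full rank means injectivity, while a semidefinite form vanishes only on the
  kernel.\<close>

lemma Sym_psd_full_rank_imp_pd:
  fixes A :: "'v::euclidean_space lin"
  assumes A: "A \<in> Sym_psd" and "lin_rank A = DIM('v)"
  shows "A \<in> Sym_pd"
proof -
  have lin: "linear (blinfun_apply A)"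
    by (simp add: blinfun.bounded_linear_right bounded_linear.linear)
  then have "subspace (range (blinfun_apply A))"
    by (intro linear_subspace_image subspace_UNIV)
  then have "surj (blinfun_apply A)"
    using assms(2) unfolding lin_rank_def dim_eq_full by (simp add: span_eq_iff[THEN iffD2])
  then have inj: "inj (blinfun_apply A)" using lin by (intro linear_surjective_imp_injective) auto
  have "0 < v \<bullet> A v" if "v \<noteq> 0" for v
  proof -
    have "A v \<noteq> 0" using inj that by (metis blinfun.zero_right injD)
    then have "v \<bullet> A v \<noteq> 0" using Sym_psd_kernel[OF A] by blast
    then show ?thesis using Sym_psdD(2)[OF A, of v] by linarith
  qed
  then show ?thesis using Sym_psdD(1)[OF A] by (simp add: Sym_pd_def)
qed

lemma lin_rank_eq_0: "lin_rank A = 0 \<Longrightarrow> A = 0"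
  by (intro blinfun_eqI) (auto simp: lin_rank_def)

text \<open>Testing the bound on \<open>S\<close> at \<open>X v\<close>, where
  \<open>S (X v) = \<nu> *\<^sub>R v\<close>, and cancelling one norm of \<open>X v\<close> gives
  \<open>norm (X v) \<le> \<nu> / c * norm v\<close>.\<close>

lemma inner_inverse_upper_bound:
  fixes X S :: "'v::euclidean_space lin"
  assumes SX: "S o\<^sub>L X = \<nu> *\<^sub>R id_blinfun" and \<nu>: "0 < \<nu>" and c: "0 < c"
    and S: "\<And>v. c * (v \<bullet> v) \<le> v \<bullet> S v"
  shows "v \<bullet> X v \<le> \<nu> / c * (v \<bullet> v)"
proof -
  have "S (X v) = \<nu> *\<^sub>R v"
    using arg_cong[OF SX, of "\<lambda>T. blinfun_apply T v"] by (simp add: blinfun.scaleR_left)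
  then have "c * (X v \<bullet> X v) \<le> \<nu> * (X v \<bullet> v)"
    using S[of "X v"] by simp
  also have "\<dots> \<le> \<nu> * (norm (X v) * norm v)"
    using \<nu> norm_cauchy_schwarz by (intro mult_left_mono) auto
  finally have "norm (X v) * (c * norm (X v)) \<le> norm (X v) * (\<nu> * norm v)"
    by (simp add: dot_square_norm power2_eq_square mult_ac)
  then have "c * norm (X v) \<le> \<nu> * norm v"
    using \<nu> by (cases "X v = 0") auto
  then have "norm (X v) \<le> \<nu> / c * norm v"
    using c by (simp add: field_simps)
  then have "norm v * norm (X v) \<le> norm v * (\<nu> / c * norm v)"
    by (intro mult_left_mono) auto
  then show ?thesis
    using norm_cauchy_schwarz[of v "X v"] by (simp add: dot_square_norm power2_eq_square mult_ac)
qed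

theorem mainTheorem2:
  fixes C :: "'v::euclidean_space lin \<Rightarrow> 'v lin"
    and D Xs Ss :: "'v lin"
    and X S :: "nat \<Rightarrow> 'v lin"
    and \<sigma> :: real
    and \<mu> :: "nat \<Rightarrow> real"
  assumes dim3: "DIM('v) = 3"
    and C_tensor: "fourth_order_tensor C"
    and C_sym: "tensor_symmetric C"
    and C_pd: "tensor_pos_def C"
    and D_Sym: "D \<in> Sym"
    and sigma: "0 < \<sigma>" "\<sigma> \<le> 1"
    and mu_pos: "\<And>k. 0 < \<mu> k"
    and mu_dec: "decseq \<mu>"
    and mu_lim: "\<mu> \<longlonglongrightarrow> 0"
    and path: "\<And>k. central_path_point C D \<sigma> (\<mu> k) (X k) (S k)"
    and X_lim: "X \<longlonglongrightarrow> Xs"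
    and S_lim: "S \<longlonglongrightarrow> Ss"
    and opt: "optimal_solution C D Xs Ss"
    and ranks: "lin_rank Xs + lin_rank Ss = 3"
  shows "(lin_rank Ss = 3 \<longrightarrow>
            Xs = 0 \<and> Bseq (\<lambda>k. condition_number (NT_schur C (X k) (S k)))) \<and>
         (lin_rank Ss = 0 \<longrightarrow>
            Xs \<in> Sym_pd \<and> Bseq (\<lambda>k. condition_number (NT_schur C (X k) (S k)))) \<and>
         (lin_rank Ss = 2 \<or> lin_rank Ss = 1 \<longrightarrow>
            (\<lambda>k. condition_number (NT_schur C (X k) (S k))) \<in> O(\<lambda>k. inverse (\<mu> k)))"
proof -
  define \<nu> where "\<nu> k = \<sigma> * \<mu> k" for k
  have \<nu>: "0 < \<nu> k" for k using sigma mu_pos by (simp add: \<nu>_def)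
  have X: "X k \<in> Sym_psd" and XS: "X k o\<^sub>L S k = \<nu> k *\<^sub>R id_blinfun" for k
    using path[of k] by (auto simp: central_path_point_def \<nu>_def intro: Sym_pd_imp_psd)
  have \<mu>_le: "\<mu> k \<le> \<mu> 0" for k using mu_dec by (simp add: decseqD)
  have \<nu>_le: "\<nu> k \<le> \<nu> 0" for k using sigma \<mu>_le by (simp add: \<nu>_def)
  obtain p q where p: "0 < p" "\<And>H. H \<in> Sym \<Longrightarrow> p * lin_inner H H \<le> lin_inner H (tensor_inverse C H)"
    and q: "0 < q" "\<And>H. H \<in> Sym \<Longrightarrow> lin_inner H (tensor_inverse C H) \<le> q * lin_inner H H"
    using tensor_pos_def_bounds[OF fourth_order_tensor_inverse tensor_symmetric_inverse
        tensor_pos_def_inverse] C_tensor C_sym C_pd by metis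
  \<comment> \<open>The open premises concern the spectral bounds \<open>a\<close> and
    \<open>b\<close> of \<open>X k\<close>, which each case below chooses for itself.\<close>
  note bound = NT_schur_condition_number_bound[OF C_tensor C_sym C_pd X XS \<nu> _ _ _ _ p q(2)]
  let ?\<kappa> = "\<lambda>k. condition_number (NT_schur C (X k) (S k))"
  obtain M where M: "0 < M" "\<And>k. norm (X k) \<le> M"
    using convergent_imp_Bseq[of X] X_lim unfolding convergent_def Bseq_def by blast
  have X_upper: "v \<bullet> X k v \<le> M * (v \<bullet> v)" for k v
    using inner_blinfun_le_norm[of v "X k"] mult_right_mono[OF M(2)[of k], of "v \<bullet> v"] by simp
  have psd: "Xs \<in> Sym_psd" "Ss \<in> Sym_psd" using opt by (auto simp: optimal_solution_def)
  have "?\<kappa> \<in> O(\<lambda>k. inverse (\<mu> k))"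
  proof (rule bigoI, rule always_eventually, rule allI)
    fix k
    \<comment> \<open>Here \<open>a = 0\<close> and \<open>b = M\<close>: the denominator is the
      constant \<open>p\<close>, and the growth comes from \<open>M^2 / \<nu> k\<close>.\<close>
    have "\<bar>?\<kappa> k\<bar> \<le> (M^2 / \<nu> k + q) / (0^2 / \<nu> k + p)"
      using M(1) X_upper Sym_psdD(2)[OF X] by (intro bound) auto
    also have "\<dots> = (M^2 / \<sigma> + q * \<mu> k) / p * inverse (\<mu> k)"
      using mu_pos[of k] sigma(1) p(1) by (simp add: \<nu>_def field_simps)
    \<comment> \<open>Monotonicity of \<open>\<mu>\<close> makes the factor of
      \<open>inverse (\<mu> k)\<close> independent of \<open>k\<close>.\<close>
    also have "\<dots> \<le> (M^2 / \<sigma> + q * \<mu> 0) / p * inverse (\<mu> k)"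
      using mu_pos[of k] p(1) q(1) \<mu>_le[of k]
      by (intro mult_right_mono divide_right_mono add_left_mono mult_left_mono) auto
    finally show "norm (?\<kappa> k) \<le> (M^2 / \<sigma> + q * \<mu> 0) / p * norm (inverse (\<mu> k))"
      using mu_pos[of k] by simp
  qed
  moreover have "Xs = 0 \<and> Bseq ?\<kappa>" if rank: "lin_rank Ss = 3"
  proof
    show "Xs = 0" using ranks rank by (intro lin_rank_eq_0) simp
    have "Ss \<in> Sym_pd" using psd rank dim3 by (intro Sym_psd_full_rank_imp_pd) auto
    then obtain c where c: "0 < c" and ev: "\<forall>\<^sub>F k in sequentially. \<forall>v. c * (v \<bullet> v) \<le> v \<bullet> S k v"
      using S_lim by (rule Sym_pd_eventually_lower_bound)
    from ev have "\<forall>\<^sub>F k in sequentially. norm (?\<kappa> k) \<le> (\<nu> 0 / c^2 + q) / p"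
    proof eventually_elim
      case (elim k)
      have SX: "S k o\<^sub>L X k = \<nu> k *\<^sub>R id_blinfun"
        by (rule blinfun_compose_eq_scaled_id_commute[OF XS]) (use \<nu>[of k] in simp)
      \<comment> \<open>The lower bound \<open>c\<close> on \<open>S k\<close> permits
        \<open>b = \<nu> k / c\<close>, whose square divided by \<open>\<nu> k\<close> is still of
        order \<open>\<nu> k\<close>.\<close>
      have "\<bar>?\<kappa> k\<bar> \<le> ((\<nu> k / c)^2 / \<nu> k + q) / (0^2 / \<nu> k + p)"
        using \<nu>[of k] c elim Sym_psdD(2)[OF X[of k]]
        by (intro bound inner_inverse_upper_bound[OF SX]) auto
      also have "\<dots> = (\<nu> k / c^2 + q) / p"
        using \<nu>[of k] by (simp add: power2_eq_square)
      also have "\<dots> \<le> (\<nu> 0 / c^2 + q) / p"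
        using \<nu>_le[of k] p(1) by (intro divide_right_mono add_right_mono) auto
      finally show ?case by simp
    qed
    then show "Bseq ?\<kappa>" by (rule BfunI)
  qed
  moreover have "Xs \<in> Sym_pd \<and> Bseq ?\<kappa>" if rank: "lin_rank Ss = 0"
  proof
    show pd: "Xs \<in> Sym_pd"
      using psd ranks rank dim3 by (intro Sym_psd_full_rank_imp_pd) auto
    obtain c where c: "0 < c" and ev: "\<forall>\<^sub>F k in sequentially. \<forall>v. c * (v \<bullet> v) \<le> v \<bullet> X k v"
      using pd X_lim by (rule Sym_pd_eventually_lower_bound)
    from ev have "\<forall>\<^sub>F k in sequentially. norm (?\<kappa> k) \<le> (M^2 + q * \<nu> 0) / c^2"
    proof eventually_elim
      case (elim k)
      have "\<bar>?\<kappa> k\<bar> \<le> (M^2 / \<nu> k + q) / (c^2 / \<nu> k + p)"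
        using M(1) X_upper c elim by (intro bound) auto
      \<comment> \<open>With \<open>p\<close> dropped from the denominator, the factor
        \<open>1 / \<nu> k\<close> cancels against the numerator.\<close>
      also have "\<dots> \<le> (M^2 / \<nu> k + q) / (c^2 / \<nu> k)"
        using \<nu>[of k] c p(1) q(1) by (intro divide_left_mono mult_pos_pos add_pos_pos) auto
      also have "\<dots> = (M^2 + q * \<nu> k) / c^2"
        using \<nu>[of k] c by (simp add: field_simps)
      also have "\<dots> \<le> (M^2 + q * \<nu> 0) / c^2"
        using \<nu>_le[of k] q(1) by (intro divide_right_mono add_left_mono mult_left_mono) auto
      finally show ?case by simp
    qed
    then show "Bseq ?\<kappa>" by (rule BfunI)
  qed
  ultimately show ?thesis by blast
qed

end
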